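(* Let $K$ be a field, let $J\subseteq I$ be monomial ideals in $R=K[x_1,\ldots,x_n]$, and let $h$ be a monomial in $R$ such that $\mathrm{supp}(h)\cap(\mathrm{supp}(I)\cup \mathrm{supp}(J))=\emptyset$. Then $J$ is a demotion of $I$ if and only if $hJ$ is a demotion of $hI$.
   Context: For ideals $J\subseteq I$ in a commutative Noetherian ring $R$, $J$ is a demotion of $I$ if $I^rJ^s=I^{r+s}\cap J^s$ for all integers $r,s\geq 0$ (with $I^0=J^0=R$). For a monomial $u$, $\mathrm{supp}(u)$ is the set of variables dividing $u$, with $\mathrm{supp}(1)=\emptyset$; for a monomial ideal $I$ with minimal set of monomial generators $\mathcal{G}(I)$, $\mathrm{supp}(I)=\bigcup_{u\in\mathcal{G}(I)}\mathrm{supp}(u)$. *)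

theory Defs
  imports
    "HOL-Library.Poly_Mapping"
    "HOL-Algebra.Ideal_Product"
    "HOL-Algebra.Algebraic_Closure_Type"
begin

text \<open>
  Powers and products of ideals are taken in the library's monoid of ideals \<open>ideals_set R\<close>,
  whose unit is \<open>carrier R\<close>; in particular the zeroth power of an ideal is \<open>R\<close>.
  The definition makes sense in any commutative ring, so Noetherianity is not required here.
\<close>

definition demotion :: "('a, 'b) ring_scheme \<Rightarrow> 'a set \<Rightarrow> 'a set \<Rightarrow> bool" where
  "demotion R J I \<longleftrightarrow>
     ideal I R \<and> ideal J R \<and> J \<subseteq> I \<and>
     (\<forall>r s :: nat.
        (I [^]\<^bsub>ideals_set R\<^esub> r) \<cdot>\<^bsub>R\<^esub> (J [^]\<^bsub>ideals_set R\<^esub> s) =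
        (I [^]\<^bsub>ideals_set R\<^esub> (r + s)) \<inter> (J [^]\<^bsub>ideals_set R\<^esub> s))"

text \<open>
  \<open>('v, 'k) mpoly\<close> is the polynomial ring over \<open>'k\<close> with one variable for each element of
  \<open>'v\<close>: finitely supported coefficient functions on finitely supported exponent vectors.
  For \<open>'v :: finite\<close> it is \<open>K[x\<^sub>1, \<dots>, x\<^sub>n]\<close> with \<open>n = CARD('v)\<close>.
\<close>

type_synonym ('v, 'k) mpoly = "('v \<Rightarrow>\<^sub>0 nat) \<Rightarrow>\<^sub>0 'k"

abbreviation mpoly_ring :: "('v, 'k::field) mpoly ring" where
  "mpoly_ring \<equiv> ring_of_type_algebra"

definition monom :: "('v \<Rightarrow>\<^sub>0 nat) \<Rightarrow> ('v, 'k::field) mpoly" where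
  "monom a = Poly_Mapping.single a 1"

definition var :: "'v \<Rightarrow> ('v, 'k::field) mpoly" where
  "var v = monom (Poly_Mapping.single v 1)"

definition monomials :: "('v, 'k::field) mpoly set" where
  "monomials = range monom"

definition monomial_ideal :: "('v, 'k::field) mpoly set \<Rightarrow> bool" where
  "monomial_ideal I \<longleftrightarrow> (\<exists>M \<subseteq> monomials. I = Idl\<^bsub>mpoly_ring\<^esub> M)"

text \<open>A monomial ideal has exactly one inclusion-minimal generating set of monomials.\<close>

definition min_gens :: "('v, 'k::field) mpoly set \<Rightarrow> ('v, 'k) mpoly set" where
  "min_gens I = (THE G. G \<subseteq> monomials \<and> Idl\<^bsub>mpoly_ring\<^esub> G = I \<and>
                        (\<forall>G'. G' \<subset> G \<longrightarrow> Idl\<^bsub>mpoly_ring\<^esub> G' \<noteq> I))"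

definition supp :: "('v, 'k::field) mpoly \<Rightarrow> ('v, 'k) mpoly set" where
  "supp u = {x \<in> range var. x dvd u}"

definition supp_ideal :: "('v, 'k::field) mpoly set \<Rightarrow> ('v, 'k) mpoly set" where
  "supp_ideal I = (\<Union>u \<in> min_gens I. supp u)"

end

theory Submission
  imports Defs
begin

text \<open>
  Since \<open>(hI)\<^sup>r = h\<^sup>r I\<^sup>r\<close>, passing from \<open>I\<close>, \<open>J\<close> to \<open>hI\<close>, \<open>hJ\<close> multiplies the product \<open>I\<^sup>r J\<^sup>s\<close> by
  \<open>h ^ (r + s)\<close>. The intersection becomes \<open>h ^ (r + s) I ^ (r + s) \<inter> h\<^sup>s J\<^sup>s\<close>, and this is
  \<open>h ^ (r + s) (I ^ (r + s) \<inter> J\<^sup>s)\<close> provided that \<open>h\<close> is cancellable, both in the ring and modulo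
  \<open>J\<^sup>s\<close>. The two demotion conditions then differ by a common cancellable factor; this part
  (\<open>demotion_scale_iff\<close>) holds in every commutative ring.

  For monomial ideals, \<open>h\<close> is cancellable modulo \<open>J\<^sup>s\<close> because \<open>J\<^sup>s\<close> is generated by products of
  generators of \<open>J\<close>, all coprime to \<open>h\<close> (\<open>exponent_ideal_power_coprime\<close>). Membership in such an ideal
  means that every term is divisible by a generator, and a monomial that divides \<open>h\<close> times a
  term and is coprime to \<open>h\<close> divides the term itself (\<open>exponent_ideal_colon_monom\<close>).

  The support of an ideal is defined through its unique minimal monomial generating set. That this
  set exists and generates, so that the support condition speaks about actual generators of \<open>J\<close>, is
  the fact that the divisibility-minimal monomials suffice and are unavoidable
  (\<open>min_gens_exponent_ideal\<close>).
\<close>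

section \<open>Ideals of a commutative ring type\<close>

lemma ring_of_type_algebra_simps [simp]:
  "carrier (ring_of_type_algebra :: 'a::ring_1 ring) = UNIV"
  "x \<otimes>\<^bsub>ring_of_type_algebra\<^esub> (y::'a) = x * y"
  "x \<oplus>\<^bsub>ring_of_type_algebra\<^esub> (y::'a) = x + y"
  "\<zero>\<^bsub>ring_of_type_algebra\<^esub> = (0::'a)"
  "\<one>\<^bsub>ring_of_type_algebra\<^esub> = (1::'a)"
  by (simp_all add: ring_of_type_algebra_def)

lemma ideal_ring_of_type_algebra_iff:
  fixes I :: "'a::comm_ring_1 set"
  shows "ideal I ring_of_type_algebra \<longleftrightarrow>
           0 \<in> I \<and> (\<forall>x\<in>I. \<forall>y\<in>I. x + y \<in> I) \<and> (\<forall>x\<in>I. \<forall>r. r * x \<in> I)"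
proof
  assume "ideal I ring_of_type_algebra"
  then interpret ideal I "ring_of_type_algebra :: 'a ring" .
  show "0 \<in> I \<and> (\<forall>x\<in>I. \<forall>y\<in>I. x + y \<in> I) \<and> (\<forall>x\<in>I. \<forall>r. r * x \<in> I)"
    using additive_subgroup.zero_closed[OF additive_subgroup_axioms]
      additive_subgroup.a_closed[OF additive_subgroup_axioms] I_l_closed by auto
next
  assume I: "0 \<in> I \<and> (\<forall>x\<in>I. \<forall>y\<in>I. x + y \<in> I) \<and> (\<forall>x\<in>I. \<forall>r. r * x \<in> I)"
  interpret cring "ring_of_type_algebra :: 'a ring" by (rule cring_from_type_algebra)
  have minus: "a_inv ring_of_type_algebra x = - x" for x :: 'a
    by (rule minus_equality) simp_all
  show "ideal I ring_of_type_algebra"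
  proof (rule idealI)
    show "subgroup I (add_monoid ring_of_type_algebra)"
    proof (rule group.subgroupI)
      show "group (add_monoid ring_of_type_algebra :: 'a monoid)" by (rule a_group)
      fix x assume "x \<in> I"
      then have "(- 1) * x \<in> I" using I by blast
      then show "inv\<^bsub>add_monoid ring_of_type_algebra\<^esub> x \<in> I"
        using minus[of x] by (simp add: a_inv_def)
    qed (use I in auto)
  qed (use I in \<open>auto simp: ring_axioms mult.commute\<close>)
qed

lemma ideal_power_Suc:
  fixes I :: "'a::comm_ring_1 set"
  shows "I [^]\<^bsub>ideals_set ring_of_type_algebra\<^esub> Suc n =
    (I [^]\<^bsub>ideals_set ring_of_type_algebra\<^esub> n) \<cdot>\<^bsub>ring_of_type_algebra\<^esub> I"
  by (simp add: nat_pow_def ideals_set_def)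

lemma ideal_power_0:
  "I [^]\<^bsub>ideals_set (ring_of_type_algebra :: 'a::comm_ring_1 ring)\<^esub> (0::nat) = UNIV"
  by (simp add: nat_pow_def ideals_set_def)

lemma ideal_prod_scale:
  fixes g h :: "'a::comm_ring_1"
  shows "((\<lambda>f. g * f) ` A) \<cdot>\<^bsub>ring_of_type_algebra\<^esub> ((\<lambda>f. h * f) ` B) =
    (\<lambda>f. g * h * f) ` (A \<cdot>\<^bsub>ring_of_type_algebra\<^esub> B)"
    (is "?L = ?R")
proof (intro equalityI subsetI)
  fix x assume "x \<in> ?L"
  then show "x \<in> ?R"
  proof induction
    case (prod i j)
    then obtain a b where ab: "a \<in> A" "b \<in> B" "i = g * a" "j = h * b" by blast
    have "a * b \<in> A \<cdot>\<^bsub>ring_of_type_algebra\<^esub> B"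
      using ideal_prod.prod[OF ab(1,2), of ring_of_type_algebra] by simp
    then show ?case using ab by (auto intro!: image_eqI[of _ _ "a * b"] simp: ac_simps)
  next
    case (sum x y)
    then obtain a b where ab: "a \<in> A \<cdot>\<^bsub>ring_of_type_algebra\<^esub> B"
      "b \<in> A \<cdot>\<^bsub>ring_of_type_algebra\<^esub> B" "x = g * h * a" "y = g * h * b" by blast
    have "a + b \<in> A \<cdot>\<^bsub>ring_of_type_algebra\<^esub> B"
      using ideal_prod.sum[OF ab(1,2)] by simp
    then show ?case using ab by (auto intro!: image_eqI[of _ _ "a + b"] simp: distrib_left)
  qed
next
  have *: "g * h * f \<in> ?L" if "f \<in> A \<cdot>\<^bsub>ring_of_type_algebra\<^esub> B" for f
    using that
  proof induction
    case (prod i j)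
    then have "(g * i) \<otimes>\<^bsub>ring_of_type_algebra\<^esub> (h * j) \<in> ?L"
      by (intro ideal_prod.prod) auto
    then show ?case by (simp add: ac_simps)
  next
    case (sum x y)
    then show ?case using ideal_prod.sum[OF sum.IH] by (simp add: distrib_left)
  qed
  fix x assume "x \<in> ?R"
  then show "x \<in> ?L" using * by blast
qed

lemma ideal_power_scale:
  fixes h :: "'a::comm_ring_1"
  shows "((\<lambda>f. h * f) ` I) [^]\<^bsub>ideals_set ring_of_type_algebra\<^esub> (n::nat) =
    (\<lambda>f. h ^ n * f) ` (I [^]\<^bsub>ideals_set ring_of_type_algebra\<^esub> n)"
proof (induction n)
  case 0
  show ?case by (simp add: ideal_power_0)
next
  case (Suc n)
  show ?case unfolding ideal_power_Suc Suc.IH ideal_prod_scale by (simp add: mult.commute)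
qed

lemma ideal_scale:
  fixes h :: "'a::comm_ring_1"
  assumes "ideal I ring_of_type_algebra"
  shows "ideal ((\<lambda>f. h * f) ` I) ring_of_type_algebra"
proof -
  have I: "0 \<in> I" "\<And>x y. x \<in> I \<Longrightarrow> y \<in> I \<Longrightarrow> x + y \<in> I" "\<And>x r. x \<in> I \<Longrightarrow> r * x \<in> I"
    using assms by (auto simp: ideal_ring_of_type_algebra_iff)
  show ?thesis
    unfolding ideal_ring_of_type_algebra_iff
  proof (intro conjI ballI allI)
    show "0 \<in> (\<lambda>f. h * f) ` I" using I(1) by (auto intro: image_eqI[of _ _ 0])
  next
    fix x y assume "x \<in> (\<lambda>f. h * f) ` I" "y \<in> (\<lambda>f. h * f) ` I"
    then show "x + y \<in> (\<lambda>f. h * f) ` I" using I(2) by (auto simp flip: distrib_left)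
  next
    fix x r assume "x \<in> (\<lambda>f. h * f) ` I"
    then show "r * x \<in> (\<lambda>f. h * f) ` I" using I(3) by (auto simp: mult.left_commute)
  qed
qed

text \<open>
  The inclusion that needs the hypothesis on \<open>J\<^sup>s\<close> is the one taking an element
  \<open>h ^ (r + s) a = h\<^sup>s b\<close> of \<open>h ^ (r + s) I ^ (r + s) \<inter> h\<^sup>s J\<^sup>s\<close> back into
  \<open>h ^ (r + s) (I ^ (r + s) \<inter> J\<^sup>s)\<close>: cancelling \<open>h\<^sup>s\<close> gives \<open>h\<^sup>r a = b \<in> J\<^sup>s\<close>, and \<open>h\<^sup>r\<close> must be
  removable there.
\<close>

lemma demotion_scale_iff:
  fixes h :: "'a::comm_ring_1"
  assumes I: "ideal I ring_of_type_algebra" and J: "ideal J ring_of_type_algebra"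
    and sub: "J \<subseteq> I"
    and inj: "inj (\<lambda>f. h * f)"
    and colon: "\<And>(s::nat) f. h * f \<in> J [^]\<^bsub>ideals_set ring_of_type_algebra\<^esub> s \<Longrightarrow>
                  f \<in> J [^]\<^bsub>ideals_set ring_of_type_algebra\<^esub> s"
  shows "demotion ring_of_type_algebra J I \<longleftrightarrow>
         demotion ring_of_type_algebra ((\<lambda>f. h * f) ` J) ((\<lambda>f. h * f) ` I)"
proof -
  let ?R = "ring_of_type_algebra :: 'a ring"
  let ?hI = "(\<lambda>f. h * f) ` I" and ?hJ = "(\<lambda>f. h * f) ` J"
  have inj_pow: "inj (\<lambda>f. h ^ n * f)" for n
  proof (induction n)
    case (Suc n)
    have "inj ((\<lambda>f. h * f) \<circ> (\<lambda>f. h ^ n * f))" by (intro inj_compose inj Suc.IH)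
    then show ?case by (simp add: o_def mult.assoc)
  qed simp
  have colon_pow: "f \<in> J [^]\<^bsub>ideals_set ?R\<^esub> s" if "h ^ r * f \<in> J [^]\<^bsub>ideals_set ?R\<^esub> s"
    for r s :: nat and f
    using that by (induction r) (auto simp: mult.assoc intro: colon)
  have "(?hI [^]\<^bsub>ideals_set ?R\<^esub> r) \<cdot>\<^bsub>?R\<^esub> (?hJ [^]\<^bsub>ideals_set ?R\<^esub> s) =
          (?hI [^]\<^bsub>ideals_set ?R\<^esub> (r + s)) \<inter> (?hJ [^]\<^bsub>ideals_set ?R\<^esub> s) \<longleftrightarrow>
        (I [^]\<^bsub>ideals_set ?R\<^esub> r) \<cdot>\<^bsub>?R\<^esub> (J [^]\<^bsub>ideals_set ?R\<^esub> s) =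
          (I [^]\<^bsub>ideals_set ?R\<^esub> (r + s)) \<inter> (J [^]\<^bsub>ideals_set ?R\<^esub> s)" for r s :: nat
  proof -
    define A where "A = I [^]\<^bsub>ideals_set ?R\<^esub> (r + s)"
    define B where "B = J [^]\<^bsub>ideals_set ?R\<^esub> s"
    have "(\<lambda>f. h ^ (r + s) * f) ` A \<inter> (\<lambda>f. h ^ s * f) ` B = (\<lambda>f. h ^ (r + s) * f) ` (A \<inter> B)"
    proof (intro equalityI subsetI)
      fix x assume "x \<in> (\<lambda>f. h ^ (r + s) * f) ` A \<inter> (\<lambda>f. h ^ s * f) ` B"
      then obtain a b where ab: "a \<in> A" "b \<in> B" "x = h ^ (r + s) * a" "x = h ^ s * b" by blast
      have "h ^ s * (h ^ r * a) = h ^ s * b" using ab by (simp add: power_add ac_simps)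
      then have "h ^ r * a \<in> B" using inj_pow[of s] ab(2) by (auto dest: injD)
      then have "a \<in> B" unfolding B_def by (rule colon_pow)
      then show "x \<in> (\<lambda>f. h ^ (r + s) * f) ` (A \<inter> B)" using ab by blast
    next
      fix x assume "x \<in> (\<lambda>f. h ^ (r + s) * f) ` (A \<inter> B)"
      then obtain a where a: "a \<in> A" "a \<in> B" "x = h ^ (r + s) * a" by blast
      have "q * b \<in> B" if "b \<in> B" for q b
      proof -
        interpret cring ?R by (rule cring_from_type_algebra)
        have "ideal B ?R"
          using monoid.nat_pow_closed[of "ideals_set ?R" J s] J
            comm_monoid.axioms(1)[OF ideals_set_is_comm_monoid]
          by (simp add: B_def ideals_set_def)
        then show ?thesis using that by (simp add: ideal_ring_of_type_algebra_iff)
      qed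
      then have "h ^ r * a \<in> B" using a(2) .
      moreover have "x = h ^ s * (h ^ r * a)" using a(3) by (simp add: power_add ac_simps)
      ultimately show "x \<in> (\<lambda>f. h ^ (r + s) * f) ` A \<inter> (\<lambda>f. h ^ s * f) ` B" using a by blast
    qed
    then show ?thesis
      unfolding ideal_power_scale ideal_prod_scale power_add[symmetric] A_def[symmetric] B_def[symmetric]
      by (simp only: inj_image_eq_iff[OF inj_pow])
  qed
  then show ?thesis
    unfolding demotion_def
    using I J sub ideal_scale[OF I, of h] ideal_scale[OF J, of h] image_mono[OF sub, of "\<lambda>f. h * f"]
    by simp
qed

section \<open>Monomial ideals through their exponents\<close>

text \<open>
  The monomial ideal generated by the \<open>x\<^sup>b\<close> with \<open>b \<in> B\<close>, given by its membership criterion rather than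
  as a generated ideal: the colon property below is read off from single terms.
\<close>

definition exponent_ideal :: "('v \<Rightarrow>\<^sub>0 nat) set \<Rightarrow> ('v, 'k::field) mpoly set" where
  "exponent_ideal B = {f. \<forall>a \<in> Poly_Mapping.keys f. \<exists>b\<in>B. \<exists>d. a = b + d}"

lemma exponent_idealI:
  assumes "\<And>a. a \<in> Poly_Mapping.keys f \<Longrightarrow> \<exists>b\<in>B. \<exists>d. a = b + d"
  shows "f \<in> exponent_ideal B"
  using assms unfolding exponent_ideal_def by blast

lemma exponent_idealE:
  assumes "f \<in> exponent_ideal B" "a \<in> Poly_Mapping.keys f"
  obtains b d where "b \<in> B" "a = b + d"
  using assms unfolding exponent_ideal_def by blast

lemma sum_single_lookup:
  "f = (\<Sum>a\<in>Poly_Mapping.keys f. Poly_Mapping.single a (Poly_Mapping.lookup f a))"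
proof (rule poly_mapping_eqI)
  fix k
  show "Poly_Mapping.lookup f k =
    Poly_Mapping.lookup (\<Sum>a\<in>Poly_Mapping.keys f. Poly_Mapping.single a (Poly_Mapping.lookup f a)) k"
    by (simp add: lookup_sum lookup_single when_def in_keys_iff)
qed

lemma ideal_exponent_ideal: "ideal (exponent_ideal B :: ('v, 'k::field) mpoly set) mpoly_ring"
proof -
  have "f + g \<in> exponent_ideal B" if "f \<in> exponent_ideal B" "g \<in> exponent_ideal B"
    for f g :: "('v, 'k) mpoly"
  proof (rule exponent_idealI)
    fix a assume "a \<in> Poly_Mapping.keys (f + g)"
    then have "a \<in> Poly_Mapping.keys f \<or> a \<in> Poly_Mapping.keys g" using keys_add[of f g] by blast
    then show "\<exists>b\<in>B. \<exists>d. a = b + d"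
    proof
      assume "a \<in> Poly_Mapping.keys f"
      with that(1) obtain b d where "b \<in> B" "a = b + d" by (rule exponent_idealE)
      then show ?thesis by (intro bexI exI)
    next
      assume "a \<in> Poly_Mapping.keys g"
      with that(2) obtain b d where "b \<in> B" "a = b + d" by (rule exponent_idealE)
      then show ?thesis by (intro bexI exI)
    qed
  qed
  moreover have "q * f \<in> exponent_ideal B" if f: "f \<in> exponent_ideal B" for q f :: "('v, 'k) mpoly"
  proof -
    have "\<exists>b\<in>B. \<exists>d. a = b + d" if "a \<in> Poly_Mapping.keys (q * f)" for a
    proof -
      from that obtain u v where uv: "v \<in> Poly_Mapping.keys f" "a = u + v"
        using keys_mult[of q f] by blast
      obtain b d where "b \<in> B" "v = b + d" using f uv(1) by (rule exponent_idealE)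
      then have "a = b + (u + d)" using uv by (simp add: ac_simps)
      then show ?thesis using \<open>b \<in> B\<close> by blast
    qed
    then show ?thesis by (rule exponent_idealI)
  qed
  moreover have "(0 :: ('v, 'k) mpoly) \<in> exponent_ideal B" by (simp add: exponent_ideal_def)
  ultimately show ?thesis unfolding ideal_ring_of_type_algebra_iff by (intro conjI ballI allI)
qed

text \<open>
  A polynomial is the sum of its terms, so an ideal contains it as soon as it contains a monomial
  dividing each of them.
\<close>

lemma exponent_ideal_subset:
  assumes I: "ideal I mpoly_ring" and B: "monom ` B \<subseteq> I"
  shows "exponent_ideal B \<subseteq> I"
proof
  fix f :: "('a, 'b) mpoly" assume f: "f \<in> exponent_ideal B"
  have I': "0 \<in> I" "\<And>x y. x \<in> I \<Longrightarrow> y \<in> I \<Longrightarrow> x + y \<in> I" "\<And>x r. x \<in> I \<Longrightarrow> r * x \<in> I"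
    using I by (auto simp: ideal_ring_of_type_algebra_iff)
  have term_in: "Poly_Mapping.single a (Poly_Mapping.lookup f a) \<in> I"
    if a: "a \<in> Poly_Mapping.keys f" for a
  proof -
    obtain b d where b: "b \<in> B" "a = b + d" using f a by (rule exponent_idealE)
    have "Poly_Mapping.single d (Poly_Mapping.lookup f a) * monom b \<in> I" using B b(1) I'(3) by blast
    then show ?thesis using b(2) by (simp add: monom_def mult_single add.commute)
  qed
  have "(\<Sum>a\<in>S. Poly_Mapping.single a (Poly_Mapping.lookup f a)) \<in> I"
    if "S \<subseteq> Poly_Mapping.keys f" for S
    using finite_subset[OF that finite_keys] that
    by (induction rule: finite_induct) (auto intro: I' term_in)
  from this[OF subset_refl] show "f \<in> I" unfolding sum_single_lookup[symmetric] .
qed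

lemma monom_in_exponent_ideal_iff:
  "(monom a :: ('v, 'k::field) mpoly) \<in> exponent_ideal B \<longleftrightarrow> (\<exists>b\<in>B. \<exists>d. a = b + d)"
  by (simp add: exponent_ideal_def monom_def)

lemma monom_image_subset_exponent_ideal: "monom ` B \<subseteq> exponent_ideal B"
proof (rule image_subsetI)
  fix b assume "b \<in> B"
  moreover have "b = b + 0" by simp
  ultimately show "monom b \<in> exponent_ideal B"
    unfolding monom_in_exponent_ideal_iff by (intro bexI[of _ b] exI[of _ 0])
qed

lemma genideal_monom_image:
  "Idl\<^bsub>mpoly_ring\<^esub> (monom ` B) = (exponent_ideal B :: ('v, 'k::field) mpoly set)"
proof
  have R: "ring (mpoly_ring :: ('v, 'k) mpoly ring)" by (rule ring_from_type_algebra)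
  show "Idl\<^bsub>mpoly_ring\<^esub> (monom ` B) \<subseteq> (exponent_ideal B :: ('v, 'k) mpoly set)"
    by (rule ring.genideal_minimal[OF R ideal_exponent_ideal monom_image_subset_exponent_ideal])
  show "(exponent_ideal B :: ('v, 'k) mpoly set) \<subseteq> Idl\<^bsub>mpoly_ring\<^esub> (monom ` B)"
    by (rule exponent_ideal_subset[OF ring.genideal_ideal[OF R] ring.genideal_self[OF R]])
      (simp_all only: ring_of_type_algebra_simps subset_UNIV)
qed

text \<open>
  The family of ideals \<open>exponent_ideal B\<close> is closed under products, which extends the criterion to
  all powers of a monomial ideal.
\<close>

lemma exponent_ideal_prod:
  "(exponent_ideal B :: ('v, 'k::field) mpoly set) \<cdot>\<^bsub>mpoly_ring\<^esub> exponent_ideal C =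
     exponent_ideal {b + c | b c. b \<in> B \<and> c \<in> C}"
    (is "?L = ?R")
proof
  have mult: "i * j \<in> ?R" if i: "i \<in> exponent_ideal B" and j: "j \<in> exponent_ideal C"
    for i j :: "('v, 'k) mpoly"
  proof -
    have "\<exists>e\<in>{b + c | b c. b \<in> B \<and> c \<in> C}. \<exists>d. a = e + d" if "a \<in> Poly_Mapping.keys (i * j)" for a
    proof -
      from that obtain u v where uv: "u \<in> Poly_Mapping.keys i" "v \<in> Poly_Mapping.keys j" "a = u + v"
        using keys_mult[of i j] by blast
      obtain b d where b: "b \<in> B" "u = b + d"
        using i uv(1) by (rule exponent_idealE)
      obtain c e where c: "c \<in> C" "v = c + e"
        using j uv(2) by (rule exponent_idealE)
      have "a = (b + c) + (d + e)" using uv b c by (simp add: ac_simps)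
      moreover have "b + c \<in> {b + c | b c. b \<in> B \<and> c \<in> C}" using b(1) c(1) by blast
      ultimately show ?thesis by (intro bexI[of _ "b + c"] exI[of _ "d + e"])
    qed
    then show ?thesis by (rule exponent_idealI)
  qed
  have add: "x + y \<in> ?R" if "x \<in> ?R" "y \<in> ?R" for x y :: "('v, 'k) mpoly"
    using additive_subgroup.a_closed[OF ideal.axioms(1)[OF ideal_exponent_ideal] that] by simp
  show "?L \<subseteq> ?R"
  proof
    fix x :: "('v, 'k) mpoly" assume "x \<in> ?L"
    then show "x \<in> ?R"
    proof (induction rule: ideal_prod.induct)
      case (prod i j)
      then show ?case by (simp add: mult)
    next
      case (sum x y)
      from add[OF sum.IH] show ?case by simp
    qed
  qed
next
  have "(monom (b + c) :: ('v, 'k) mpoly) \<in> ?L" if "b \<in> B" "c \<in> C" for b c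
  proof -
    have "(monom b :: ('v, 'k) mpoly) \<otimes>\<^bsub>mpoly_ring\<^esub> monom c \<in> ?L"
      by (rule ideal_prod.prod;
          rule subsetD[OF monom_image_subset_exponent_ideal imageI]; rule that)
    then show ?thesis by (simp add: monom_def mult_single)
  qed
  then have "monom ` {b + c | b c. b \<in> B \<and> c \<in> C} \<subseteq> ?L" by blast
  then show "?R \<subseteq> ?L"
    by (rule exponent_ideal_subset[OF ring.ideal_prod_is_ideal[OF ring_from_type_algebra
            ideal_exponent_ideal ideal_exponent_ideal]])
qed

section \<open>Minimal monomial generators\<close>

definition minimal_exponents :: "('v \<Rightarrow>\<^sub>0 nat) set \<Rightarrow> ('v \<Rightarrow>\<^sub>0 nat) set" where
  "minimal_exponents B = {b \<in> B. \<forall>c\<in>B. \<forall>d. b = c + d \<longrightarrow> d = 0}"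

text \<open>Splitting off a nonzero exponent lowers the total degree, so descent ends at a minimal one.\<close>

lemma minimal_exponent_below:
  fixes B :: "('v::finite \<Rightarrow>\<^sub>0 nat) set"
  assumes "b \<in> B"
  shows "\<exists>m\<in>minimal_exponents B. \<exists>d. b = m + d"
  using assms
proof (induction "\<Sum>v\<in>UNIV. Poly_Mapping.lookup b v" arbitrary: b rule: less_induct)
  case less
  show ?case
  proof (cases "b \<in> minimal_exponents B")
    case True
    then show ?thesis by (intro bexI[of _ b] exI[of _ 0]) simp_all
  next
    case False
    then obtain c d where cd: "c \<in> B" "b = c + d" "d \<noteq> 0"
      using less.prems by (auto simp: minimal_exponents_def)
    from \<open>d \<noteq> 0\<close> obtain w where "Poly_Mapping.lookup d w \<noteq> 0"
      by (metis lookup_zero poly_mapping_eqI)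
    then have "0 < (\<Sum>v\<in>UNIV. Poly_Mapping.lookup d v)"
      by (intro sum_pos2[of _ w]) auto
    then have "(\<Sum>v\<in>UNIV. Poly_Mapping.lookup c v) < (\<Sum>v\<in>UNIV. Poly_Mapping.lookup b v)"
      by (simp add: cd(2) lookup_add sum.distrib)
    from less.hyps[OF this cd(1)] obtain m e where "m \<in> minimal_exponents B" "c = m + e" by blast
    then show ?thesis using cd(2) by (auto simp: add.assoc)
  qed
qed

lemma exponent_ideal_minimal_exponents:
  fixes B :: "('v::finite \<Rightarrow>\<^sub>0 nat) set"
  shows "exponent_ideal (minimal_exponents B) = (exponent_ideal B :: ('v, 'k::field) mpoly set)"
proof
  show "exponent_ideal (minimal_exponents B) \<subseteq> (exponent_ideal B :: ('v, 'k) mpoly set)"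
    unfolding exponent_ideal_def minimal_exponents_def by blast
  show "(exponent_ideal B :: ('v, 'k) mpoly set) \<subseteq> exponent_ideal (minimal_exponents B)"
    using minimal_exponent_below[of _ B]
    by (intro exponent_ideal_subset ideal_exponent_ideal) (auto simp: monom_in_exponent_ideal_iff)
qed

text \<open>
  A monomial in the ideal is divisible by a generator \<open>x\<^sup>c\<close>, and \<open>x\<^sup>c\<close> by some \<open>x\<^sup>b\<close> with \<open>b \<in> B\<close>. For a
  minimal exponent all three have to agree.
\<close>

lemma minimal_exponents_subset:
  assumes "exponent_ideal C = (exponent_ideal B :: ('v, 'k::field) mpoly set)"
  shows "minimal_exponents B \<subseteq> C"
proof
  fix m assume m: "m \<in> minimal_exponents B"
  then have "(monom m :: ('v, 'k) mpoly) \<in> exponent_ideal C"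
    using monom_image_subset_exponent_ideal[of B] assms by (auto simp: minimal_exponents_def)
  then obtain c d where c: "c \<in> C" "m = c + d" by (auto simp: monom_in_exponent_ideal_iff)
  have "(monom c :: ('v, 'k) mpoly) \<in> exponent_ideal B"
    using monom_image_subset_exponent_ideal[of C] assms c(1) by blast
  then obtain b e where b: "b \<in> B" "c = b + e" by (auto simp: monom_in_exponent_ideal_iff)
  have "m = b + (e + d)" using b c by (simp add: add.assoc)
  with m b(1) have "e + d = 0" by (auto simp: minimal_exponents_def)
  then have "d = 0"
    by (metis add_is_0 lookup_add lookup_zero poly_mapping_eqI)
  then show "m \<in> C" using c by simp
qed

text \<open>
  The minimal exponents generate the ideal and lie in every monomial generating set, so they give
  the unique inclusion-minimal one; hence the definite description denotes it.
\<close>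

lemma min_gens_exponent_ideal:
  fixes B :: "('v::finite \<Rightarrow>\<^sub>0 nat) set"
  shows "min_gens (exponent_ideal B :: ('v, 'k::field) mpoly set) = monom ` minimal_exponents B"
proof -
  let ?M = "monom ` minimal_exponents B :: ('v, 'k) mpoly set"
  let ?I = "exponent_ideal B :: ('v, 'k) mpoly set"
  have gen: "Idl\<^bsub>mpoly_ring\<^esub> ?M = ?I"
    by (simp add: genideal_monom_image exponent_ideal_minimal_exponents)
  have least: "?M \<subseteq> G" if "G \<subseteq> monomials" "Idl\<^bsub>mpoly_ring\<^esub> G = ?I" for G
  proof -
    obtain C where G: "G = monom ` C"
      using \<open>G \<subseteq> monomials\<close> unfolding monomials_def by (blast elim: subset_imageE)
    then have "exponent_ideal C = ?I" using that(2) by (simp add: genideal_monom_image)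
    then show ?thesis using minimal_exponents_subset[of C B] G by blast
  qed
  show ?thesis
    unfolding min_gens_def
  proof (rule the_equality)
    show "?M \<subseteq> monomials \<and> Idl\<^bsub>mpoly_ring\<^esub> ?M = ?I \<and>
      (\<forall>G'. G' \<subset> ?M \<longrightarrow> Idl\<^bsub>mpoly_ring\<^esub> G' \<noteq> ?I)"
    proof (intro conjI allI impI gen)
      show M: "?M \<subseteq> monomials" by (auto simp: monomials_def)
      fix G' assume "G' \<subset> ?M"
      then show "Idl\<^bsub>mpoly_ring\<^esub> G' \<noteq> ?I" using least[of G'] M by blast
    qed
  next
    fix G assume "G \<subseteq> monomials \<and> Idl\<^bsub>mpoly_ring\<^esub> G = ?I \<and>
      (\<forall>G'. G' \<subset> G \<longrightarrow> Idl\<^bsub>mpoly_ring\<^esub> G' \<noteq> ?I)"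
    then show "G = ?M" using least[of G] gen by blast
  qed
qed

section \<open>Monomials coprime to the generators\<close>

definition coprime_exponents :: "('v \<Rightarrow>\<^sub>0 nat) \<Rightarrow> ('v \<Rightarrow>\<^sub>0 nat) \<Rightarrow> bool" where
  "coprime_exponents a b \<longleftrightarrow> (\<forall>v. Poly_Mapping.lookup a v = 0 \<or> Poly_Mapping.lookup b v = 0)"

lemma var_dvd_monom:
  assumes "Poly_Mapping.lookup a v \<noteq> 0"
  shows "(var v :: ('v, 'k::field) mpoly) dvd monom a"
proof -
  have "Poly_Mapping.single v 1 + (a - Poly_Mapping.single v 1) = a"
    using assms by (intro poly_mapping_eqI) (auto simp: lookup_add lookup_minus lookup_single when_def)
  then have "(monom a :: ('v, 'k) mpoly) = var v * monom (a - Poly_Mapping.single v 1)"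
    by (simp add: var_def monom_def mult_single)
  then show ?thesis by simp
qed

lemma coprime_exponents_if_disjoint_supp:
  assumes "supp (monom a :: ('v, 'k::field) mpoly) \<inter> supp (monom b) = {}"
  shows "coprime_exponents a b"
proof -
  have "Poly_Mapping.lookup a v = 0 \<or> Poly_Mapping.lookup b v = 0" for v
    using assms var_dvd_monom[of a v, where 'k='k] var_dvd_monom[of b v, where 'k='k]
    by (auto simp: supp_def)
  then show ?thesis by (simp add: coprime_exponents_def)
qed

text \<open>
  Multiplication by \<open>x\<^sup>c\<close> shifts the coefficient function, so \<open>f\<close> can be recovered from \<open>x\<^sup>c f\<close>.
\<close>

lemma lookup_monom_mult:
  "Poly_Mapping.lookup ((monom c :: ('v, 'k::field) mpoly) * f) (c + a) = Poly_Mapping.lookup f a"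
  by (simp add: lookup_mult monom_def lookup_single when_mult)

lemma inj_monom_mult: "inj (\<lambda>f. (monom c :: ('v, 'k::field) mpoly) * f)"
  by (rule injI) (metis lookup_monom_mult poly_mapping_eqI)

text \<open>
  Membership is tested term by term, and each term of \<open>x\<^sup>c f\<close> is \<open>x\<^sup>c\<close> times a term of \<open>f\<close>. A
  generator coprime to \<open>x\<^sup>c\<close> that divides such a product divides the term of \<open>f\<close>.
\<close>

lemma exponent_ideal_colon_monom:
  fixes f :: "('v, 'k::field) mpoly"
  assumes B: "\<And>b. b \<in> B \<Longrightarrow> coprime_exponents c b"
    and f: "monom c * f \<in> exponent_ideal B"
  shows "f \<in> exponent_ideal B"
proof -
  have "\<exists>b\<in>B. \<exists>d. a = b + d" if "a \<in> Poly_Mapping.keys f" for a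
  proof -
    have "c + a \<in> Poly_Mapping.keys (monom c * f)"
      using that by (simp add: in_keys_iff lookup_monom_mult)
    with f obtain b d where b: "b \<in> B" "c + a = b + d" by (rule exponent_idealE)
    have "Poly_Mapping.lookup b v \<le> Poly_Mapping.lookup a v" for v
    proof -
      have "Poly_Mapping.lookup c v + Poly_Mapping.lookup a v =
          Poly_Mapping.lookup b v + Poly_Mapping.lookup d v"
        using b(2) by (metis lookup_add)
      then show ?thesis using B[OF b(1)] by (auto simp: coprime_exponents_def dest: spec[of _ v])
    qed
    then have "a = b + (a - b)"
      by (intro poly_mapping_eqI) (simp add: lookup_add lookup_minus)
    then show ?thesis using b(1) by blast
  qed
  then show ?thesis by (rule exponent_idealI)
qed

text \<open>
  The exponents coprime to \<open>c\<close> are closed under addition, so they still suffice to generate the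
  powers. The zeroth power is the unit ideal, generated by \<open>x\<^sup>0 = 1\<close>.
\<close>

lemma exponent_ideal_power_coprime:
  assumes "\<And>b. b \<in> B \<Longrightarrow> coprime_exponents c b"
  shows "\<exists>C. (\<forall>b\<in>C. coprime_exponents c b) \<and>
    (exponent_ideal B :: ('v, 'k::field) mpoly set) [^]\<^bsub>ideals_set mpoly_ring\<^esub> (s::nat) = exponent_ideal C"
proof (induction s)
  case 0
  have "exponent_ideal {0} = (UNIV :: ('v, 'k) mpoly set)" by (auto simp: exponent_ideal_def)
  then show ?case
    unfolding ideal_power_0 by (intro exI[of _ "{0}"]) (simp add: coprime_exponents_def)
next
  case (Suc s)
  then obtain C where C: "\<forall>b\<in>C. coprime_exponents c b"
    "(exponent_ideal B :: ('v, 'k) mpoly set) [^]\<^bsub>ideals_set mpoly_ring\<^esub> s = exponent_ideal C"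
    by blast
  show ?case
  proof (intro exI conjI)
    have "coprime_exponents c (b + b')" if bb': "b \<in> C" "b' \<in> B" for b b'
    proof -
      have "coprime_exponents c b" "coprime_exponents c b'" using C(1) assms bb' by auto
      then show ?thesis unfolding coprime_exponents_def lookup_add by fastforce
    qed
    then show "\<forall>e\<in>{b + b' | b b'. b \<in> C \<and> b' \<in> B}. coprime_exponents c e" by auto
  qed (simp only: ideal_power_Suc C(2) exponent_ideal_prod)
qed

lemma monomial_idealE:
  assumes "monomial_ideal (I :: ('v, 'k::field) mpoly set)"
  obtains B where "I = exponent_ideal B"
proof -
  obtain M where M: "M \<subseteq> monomials" "I = Idl\<^bsub>mpoly_ring\<^esub> M"
    using assms by (auto simp: monomial_ideal_def)
  from M(1) obtain B where "M = monom ` B" unfolding monomials_def by (blast elim: subset_imageE)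
  then show thesis using M(2) that by (simp add: genideal_monom_image)
qed

theorem proposition5p10:
  fixes I J :: "('v::finite, 'k::field) mpoly set"
    and h :: "('v, 'k) mpoly"
  assumes "monomial_ideal I" and "monomial_ideal J" and "J \<subseteq> I"
    and "h \<in> monomials"
    and "supp h \<inter> (supp_ideal I \<union> supp_ideal J) = {}"
  shows "demotion mpoly_ring J I \<longleftrightarrow>
         demotion mpoly_ring ((\<lambda>f. h * f) ` J) ((\<lambda>f. h * f) ` I)"
proof -
  obtain A where A: "I = exponent_ideal A" using assms(1) by (rule monomial_idealE)
  obtain B' where B': "J = exponent_ideal B'" using assms(2) by (rule monomial_idealE)
  \<comment> \<open>The support hypothesis covers the minimal generators only, so \<open>J\<close> is represented by them.\<close>
  define B where "B = minimal_exponents B'"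
  have B: "J = exponent_ideal B" by (simp add: B_def B' exponent_ideal_minimal_exponents)
  obtain c where c: "h = monom c" using assms(4) by (auto simp: monomials_def)
  have coprime: "coprime_exponents c b" if "b \<in> B" for b
  proof (rule coprime_exponents_if_disjoint_supp[where 'k='k])
    have "supp (monom b) \<subseteq> supp_ideal J"
      using that by (auto simp: supp_ideal_def B' min_gens_exponent_ideal B_def)
    then show "supp (monom c :: ('v, 'k) mpoly) \<inter> supp (monom b) = {}"
      using assms(5) c by blast
  qed
  show ?thesis
  proof (rule demotion_scale_iff)
    show "ideal I mpoly_ring" "ideal J mpoly_ring" by (simp_all add: A B ideal_exponent_ideal)
    show "inj (\<lambda>f. h * f)" unfolding c by (rule inj_monom_mult)
    fix s :: nat and f
    obtain C where C: "\<forall>b\<in>C. coprime_exponents c b"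
      "J [^]\<^bsub>ideals_set mpoly_ring\<^esub> s = exponent_ideal C"
      using exponent_ideal_power_coprime[of B c s] coprime unfolding B by blast
    assume "h * f \<in> J [^]\<^bsub>ideals_set mpoly_ring\<^esub> s"
    then show "f \<in> J [^]\<^bsub>ideals_set mpoly_ring\<^esub> s"
      using exponent_ideal_colon_monom[of C c f] C c by simp
  qed (rule assms(3))
qed

end
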